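(* Let $d\ge 1$ and $n\ge 1$ be integers, and let $\mathcal{P}_0,\mathcal{P}_1,\ldots,\mathcal{P}_n\subset\mathbb{R}^d$ be polytopes. Suppose that all $\mathcal{P}_i$, $i\in\{0,1,\ldots,n\}$, are nonempty and that $\mathcal{P}_k$ is full dimensional for some $k\in\{1,\ldots,n\}$. Then the inequality $\sum_{j=1}^n z_j\le 1$ describes a facet of $$\mathcal{D}:=\operatorname{conv}\left(\bigcup_{i=0}^n\left\{\begin{pmatrix}x\\ \mathbf{e}_i\end{pmatrix} : x\in\mathcal{P}_i\right\}\right)\subset\mathbb{R}^{d+n}.$$
   Context: $\mathbf{e}_i$ denotes the $i$-th standard unit vector of $\mathbb{R}^n$ for $i\in\{1,\ldots,n\}$, and $\mathbf{e}_0$ denotes the zero vector of $\mathbb{R}^n$. Points of $\mathbb{R}^{d+n}$ are written $\begin{pmatrix}x\\ z\end{pmatrix}$ with $x\in\mathbb{R}^d$, $z=(z_1,\ldots,z_n)^\top\in\mathbb{R}^n$. The face described by an inequality valid for a polytope is the set of points of the polytope satisfying it with equality. The dimension of a polytope is one less than the maximum number of affinely independent points in it; a polytope in $\mathbb{R}^m$ is full dimensional if its dimension is $m$; a facet is a face of dimension one less than that of the polytope. *)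

theory Defs
  imports "HOL-Analysis.Analysis"
begin

text \<open>
  The index set \<open>{0, 1, \<dots>, n}\<close> is rendered as \<open>'n option\<close>: \<open>None\<close> is the index \<open>0\<close>
  and \<open>Some i\<close> ranges over the coordinates of \<open>\<real>\<^sup>n\<close>.  The space \<open>\<real>\<^sup>d\<^sup>+\<^sup>n\<close> is the Euclidean
  space of pairs \<open>(x, z)\<close>.
\<close>

fun unit_vec :: "'n option \<Rightarrow> real ^ 'n" where
  "unit_vec None = 0"
| "unit_vec (Some i) = axis i 1"

definition disj_hull ::
  "('n::finite option \<Rightarrow> (real ^ 'd::finite) set) \<Rightarrow> ((real ^ 'd) \<times> (real ^ 'n)) set" where
  "disj_hull P = convex hull (\<Union>i. {(x, unit_vec i) | x. x \<in> P i})"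

definition full_dimensional :: "'a::euclidean_space set \<Rightarrow> bool" where
  "full_dimensional S \<longleftrightarrow> aff_dim S = int DIM('a)"

text \<open>The inequality \<open>f p \<le> b\<close> has to be valid on \<open>S\<close> for it to describe a face at all.\<close>

definition describes_facet :: "('a::euclidean_space \<Rightarrow> real) \<Rightarrow> real \<Rightarrow> 'a set \<Rightarrow> bool" where
  "describes_facet f b S \<longleftrightarrow> (\<forall>p\<in>S. f p \<le> b) \<and> {p \<in> S. f p = b} facet_of S"

end

theory Submission
  imports Defs
begin

text \<open>
  Let \<open>H\<close> be the hyperplane \<open>\<Sum>\<^sub>j z\<^sub>j = 1\<close>. The inequality holds at every generator
  \<open>(x, e\<^sub>i)\<close>, so it is valid on the hull, and the hull meets \<open>H\<close> in a face \<open>F\<close>. The point is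
  that \<open>F\<close> affinely spans \<open>H\<close>. Choose \<open>k\<close> with \<open>P\<^sub>k\<close> full dimensional and points
  \<open>y\<^sub>j \<in> P\<^sub>j\<close>. The affine hull of \<open>F\<close> contains the whole fibre
  \<open>\<real>\<^sup>d \<times> {e\<^sub>k}\<close>, because \<open>P\<^sub>k\<close> affinely spans \<open>\<real>\<^sup>d\<close>. So each
  \<open>(y\<^sub>j, e\<^sub>j) - (y\<^sub>j, e\<^sub>k)\<close> is a difference of two points of the affine hull, and
  adding combinations of these directions to the fibre over \<open>e\<^sub>k\<close> gives every point of \<open>H\<close>
  (\<open>affine_contains_unit_sum_hyperplane\<close>). Hence \<open>F\<close> has
  codimension one in the ambient space. Since \<open>P\<^sub>0\<close> is nonempty, the hull contains a point
  \<open>(y\<^sub>0, 0)\<close> outside \<open>H\<close>, so the hull itself is full dimensional and \<open>F\<close> is a facet.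
\<close>

lemma affine_plus_sum_differences:
  fixes a :: "'a::real_vector"
  assumes "affine S" "a \<in> S" "\<And>t. t \<in> T \<Longrightarrow> u t \<in> S" "\<And>t. t \<in> T \<Longrightarrow> v t \<in> S"
  shows "a + (\<Sum>t\<in>T. c t *\<^sub>R (u t - v t)) \<in> S"
  using assms(3,4)
proof (induction T rule: infinite_finite_induct)
  case (insert t T)
  then have "(a + (\<Sum>t\<in>T. c t *\<^sub>R (u t - v t))) + c t *\<^sub>R (u t - v t) \<in> S"
    by (intro mem_affine_3_minus[OF assms(1)]) auto
  then show ?case
    using insert by (simp add: algebra_simps)
qed (use assms in auto)

lemma affine_fibre:
  assumes "affine A"
  shows "affine {x. (x, b) \<in> A}"
  unfolding affine_def
proof (clarsimp, goal_cases)
  case (1 x y u v)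
  then have "u *\<^sub>R (x, b) + v *\<^sub>R (y, b) \<in> A"
    by (intro mem_affine[OF assms])
  moreover have "u *\<^sub>R b + v *\<^sub>R b = b"
    using \<open>u + v = 1\<close> by (simp flip: scaleR_left_distrib)
  ultimately show ?case
    by simp
qed

text \<open>Points of the hyperplane of coordinate sum one are reached from a full fibre \<open>\<real>\<^sup>d \<times> {e\<^sub>k}\<close>:
  the coefficients that \<open>z\<close> puts on the differences \<open>e\<^sub>j - e\<^sub>k\<close> are its own coordinates, because
  \<open>z = e\<^sub>k + \<Sum>\<^sub>j z\<^sub>j (e\<^sub>j - e\<^sub>k)\<close> as soon as \<open>\<Sum>\<^sub>j z\<^sub>j = 1\<close>.\<close>

lemma affine_contains_unit_sum_hyperplane:
  fixes A :: "('a::real_vector \<times> (real ^ 'n::finite)) set"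
  assumes A: "affine A"
    and fibre: "\<And>x. (x, axis k 1) \<in> A"
    and points: "\<And>j. (y j, axis j 1) \<in> A"
    and z: "(\<Sum>j\<in>UNIV. z $ j) = 1"
  shows "(x, z) \<in> A"
proof -
  have "(x, axis k 1) + (\<Sum>j\<in>UNIV. (z $ j) *\<^sub>R ((y j, axis j 1) - (y j, axis k 1))) \<in> A"
    by (intro affine_plus_sum_differences A fibre points)
  moreover have "axis k 1 + (\<Sum>j\<in>UNIV. (z $ j) *\<^sub>R (axis j 1 - axis k 1)) = z"
  proof -
    have "(\<Sum>j\<in>UNIV. (z $ j) *\<^sub>R (axis j 1 :: real ^ 'n)) = z"
      using basis_expansion[of z] by (simp add: scalar_mult_eq_scaleR)
    then show ?thesis
      by (simp add: scaleR_right_diff_distrib sum_subtractf z flip: scaleR_sum_left)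
  qed
  ultimately show ?thesis
    by (simp add: sum_prod)
qed

lemma sum_unit_vec: "(\<Sum>j\<in>UNIV. unit_vec i $ j) = (if i = None then 0 else 1)"
  by (cases i) (auto simp: axis_def)

theorem theorem5:
  fixes P :: "'n::finite option \<Rightarrow> (real ^ 'd::finite) set"
  assumes "\<And>i. polytope (P i)"
    and "\<And>i. P i \<noteq> {}"
    and "\<exists>k. full_dimensional (P (Some k))"
  shows "describes_facet (\<lambda>(x, z). \<Sum>j\<in>UNIV. z $ j) 1 (disj_hull P)"
proof -
  let ?a = "(0, 1) :: (real ^ 'd) \<times> (real ^ 'n)"
  let ?D = "disj_hull P"
  define H where "H = {p. ?a \<bullet> p = 1}"
  define F where "F = ?D \<inter> H"
  have coord_sum: "(case p of (x, z) \<Rightarrow> \<Sum>j\<in>UNIV. z $ j) = ?a \<bullet> p" for p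
    by (cases p) (simp add: inner_vec_def)
  have generator: "(x, unit_vec i) \<in> ?D" if "x \<in> P i" for x i
    unfolding disj_hull_def using that by (intro hull_inc) auto
  have valid: "?a \<bullet> p \<le> 1" if "p \<in> ?D" for p
  proof -
    have "?D \<subseteq> {p. ?a \<bullet> p \<le> 1}"
      unfolding disj_hull_def
      by (intro hull_minimal convex_halfspace_le)
         (auto simp: sum_unit_vec simp flip: coord_sum)
    then show ?thesis using that by auto
  qed
  have face: "F face_of ?D"
    unfolding F_def H_def using valid
    by (intro face_of_Int_supporting_hyperplane_le) (auto simp: disj_hull_def)

  obtain k where "full_dimensional (P (Some k))"
    using assms(3) by blast
  then have span: "affine hull (P (Some k)) = UNIV"
    using aff_dim_eq_full[of "P (Some k)"] by (simp only: full_dimensional_def)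
  define y where "y i = (SOME x. x \<in> P i)" for i
  have y: "y i \<in> P i" for i
    using assms(2)[of i] unfolding y_def by (simp add: some_in_eq)
  have in_F: "(x, axis j 1) \<in> F" if "x \<in> P (Some j)" for x j
    using generator[OF that] sum_unit_vec[of "Some j"] coord_sum[of "(x, axis j 1)"]
    by (simp add: F_def H_def)
  have fibre: "(x, axis k 1) \<in> affine hull F" for x
  proof -
    have "affine hull (P (Some k)) \<subseteq> {x. (x, axis k 1) \<in> affine hull F}"
      by (intro hull_minimal affine_fibre) (auto intro: hull_inc in_F)
    then show ?thesis
      by (auto simp: span)
  qed
  have points: "(y (Some j), axis j 1) \<in> affine hull F" for j
    by (intro hull_inc in_F y)
  have "(x, z) \<in> affine hull F" if "(\<Sum>j\<in>UNIV. z $ j) = 1" for x z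
    using affine_contains_unit_sum_hyperplane[OF affine_affine_hull fibre points that] .
  then have spans_H: "H \<subseteq> affine hull F"
    by (auto simp: H_def simp flip: coord_sum)
  have H: "affine hull F = H"
    using spans_H
    by (intro equalityI hull_minimal) (auto simp: F_def H_def affine_hyperplane)
  have "?a \<noteq> 0"
    by (simp add: zero_prod_def)
  then have dim_F: "aff_dim F = int DIM((real ^ 'd) \<times> (real ^ 'n)) - 1"
    using aff_dim_affine_hull[of F] aff_dim_hyperplane[of ?a 1]
      DIM_positive[where 'a = "(real ^ 'd) \<times> (real ^ 'n)"]
    unfolding H H_def by linarith

  \<comment> \<open>The generator over the index \<open>0\<close> lies off \<open>H\<close> and raises the dimension by one.\<close>
  have "aff_dim (insert (y None, 0) F) \<le> aff_dim ?D"
    using generator[OF y[of None]] by (intro aff_dim_subset) (auto simp: F_def)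
  then have "aff_dim ?D = int DIM((real ^ 'd) \<times> (real ^ 'n))"
    using dim_F aff_dim_le_DIM[of ?D] by (simp add: aff_dim_insert H H_def)
  then have "F facet_of ?D"
    using face dim_F in_F[OF y] by (auto simp: facet_of_def)
  moreover have "{p \<in> ?D. ?a \<bullet> p = 1} = F"
    by (auto simp: F_def H_def)
  ultimately show ?thesis
    using valid by (simp add: describes_facet_def coord_sum)
qed

end
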